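(* For all positive integers $a$ and $b$, either $f(a)\ge a+b$ or $f(a+b)\le a+2b$ (inclusive or), where $f(n):=R(C_4,K_{1,n})$.
   Context: Graphs are finite, simple and undirected. $G\supseteq H$ means that $H$ is isomorphic to a (not necessarily induced) subgraph of $G$; $\overline{G}$ is the complement of $G$. $C_4$ is the cycle on $4$ vertices and $K_{1,n}$ is the star on $n+1$ vertices (one center joined to $n$ leaves). The Ramsey number $R(H_1,H_2)$ is the smallest integer $N$ such that for every graph $G$ with $N$ vertices, either $G\supseteq H_1$ or $\overline{G}\supseteq H_2$. For a positive integer $n$, $f(n):=R(C_4,K_{1,n})$. *)

theory Defs
  imports "HOL-Library.Ramsey" "Graph_Theory.Graph_Theory"
begin

(* A finite simple undirected graph is a "pair_graph": a finite, loop-free digraph without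
   parallel arcs whose arc set is symmetric.  The undirected edge uv is the pair of arcs
   (u,v), (v,u). *)

definition graph_complement :: "'a pair_pre_digraph \<Rightarrow> 'a pair_pre_digraph" where
  "graph_complement G =
     \<lparr> pverts = pverts G,
       parcs = {(u, v). u \<in> pverts G \<and> v \<in> pverts G \<and> u \<noteq> v \<and> (u, v) \<notin> parcs G} \<rparr>"

definition contains_copy :: "'a pair_pre_digraph \<Rightarrow> 'b pair_pre_digraph \<Rightarrow> bool" where
  "contains_copy G H \<longleftrightarrow>
     (\<exists>S. subgraph S (with_proj G) \<and> digraph_iso (with_proj H) S)"

definition cycle4 :: "nat pair_pre_digraph" where
  "cycle4 = \<lparr> pverts = {0, 1, 2, 3},
              parcs = {(0, 1), (1, 2), (2, 3), (3, 0)} \<union> {(1, 0), (2, 1), (3, 2), (0, 3)} \<rparr>"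

definition star :: "nat \<Rightarrow> nat pair_pre_digraph" where
  "star n = \<lparr> pverts = {0..n}, parcs = {0} \<times> {1..n} \<union> {1..n} \<times> {0} \<rparr>"

(* Every finite graph is isomorphic to one whose vertices are natural numbers, so letting G
   range over graphs with vertices in nat loses no generality. *)
definition ramsey_number :: "'a pair_pre_digraph \<Rightarrow> 'b pair_pre_digraph \<Rightarrow> nat" where
  "ramsey_number H1 H2 =
     (LEAST N. \<forall>G :: nat pair_pre_digraph. pair_graph G \<and> card (pverts G) = N \<longrightarrow>
        contains_copy G H1 \<or> contains_copy (graph_complement G) H2)"

definition ramsey_C4_star :: "nat \<Rightarrow> nat" where
  "ramsey_C4_star n = ramsey_number cycle4 (star n)"


lemma pair_graphI:
  assumes "finite (pverts G)" "parcs G \<subseteq> pverts G \<times> pverts G"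
    "sym (parcs G)" "\<And>v. (v, v) \<notin> parcs G"
  shows "pair_graph G"
proof -
  have "finite (parcs G)" using assms(1,2) by (meson finite_SigmaI finite_subset)
  then show ?thesis using assms
    by unfold_locales (auto simp: symmetric_def)
qed

lemma pair_graph_complement:
  assumes "pair_graph G" shows "pair_graph (graph_complement G)"
proof -
  interpret pair_graph G by fact
  have "sym (parcs G)" using pair_sym_arcs by (simp add: symmetric_def)
  then show ?thesis
    by (intro pair_graphI) (auto simp: graph_complement_def sym_def)
qed

lemma pair_graph_cycle4: "pair_graph cycle4"
  by (rule pair_graphI) (auto simp: cycle4_def sym_def)

lemma complete_bipartite_star: "complete_bipartite_digraph 1 n (with_proj (star n))"
proof -
  have "pair_graph (star n)"
    by (rule pair_graphI) (auto simp: star_def sym_def)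
  then interpret pair_graph "star n" .
  have "graph (with_proj (star n))" by unfold_locales
  then show ?thesis unfolding complete_bipartite_digraph_def
    by (intro conjI exI[of _ "{0}"] exI[of _ "{1..n}"])
       (auto simp: star_def)
qed

lemma contains_copy_iff_embedding:
  assumes "pair_graph G" "pair_graph H"
  shows "contains_copy G H \<longleftrightarrow>
    (\<exists>g. inj_on g (pverts H) \<and> g ` pverts H \<subseteq> pverts G \<and>
         (\<forall>u v. (u, v) \<in> parcs H \<longrightarrow> (g u, g v) \<in> parcs G))"
proof
  interpret G: pair_graph G by fact
  interpret H: pair_graph H by fact
  {
    assume "contains_copy G H"
    then obtain S h where S: "subgraph S (with_proj G)" "S = app_iso h (with_proj H)"
      and h: "pre_digraph.digraph_isomorphism (with_proj H) h"
      unfolding contains_copy_def digraph_iso_def by blast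
    have h': "inj_on (iso_verts h) (pverts H)"
      "\<And>e. e \<in> parcs H \<Longrightarrow> iso_verts h (fst e) = iso_tail h (iso_arcs h e) \<and>
             iso_verts h (snd e) = iso_head h (iso_arcs h e)"
      using h unfolding pre_digraph.digraph_isomorphism_def by auto
    have S': "iso_verts h ` pverts H \<subseteq> pverts G" "iso_arcs h ` parcs H \<subseteq> parcs G"
      "iso_tail h = fst" "iso_head h = snd"
      using S unfolding subgraph_def compatible_def by auto
    have "(iso_verts h u, iso_verts h v) \<in> parcs G" if "(u, v) \<in> parcs H" for u v
    proof -
      have "iso_arcs h (u, v) = (iso_verts h u, iso_verts h v)"
        using h'(2)[OF that] S'(3,4) by (simp add: prod_eq_iff)
      then show ?thesis using that S'(2) by (metis image_subset_iff)
    qed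
    then show "\<exists>g. inj_on g (pverts H) \<and> g ` pverts H \<subseteq> pverts G \<and>
        (\<forall>u v. (u, v) \<in> parcs H \<longrightarrow> (g u, g v) \<in> parcs G)"
      using h'(1) S'(1) by (intro exI[of _ "iso_verts h"]) auto
  next
    assume "\<exists>g. inj_on g (pverts H) \<and> g ` pverts H \<subseteq> pverts G \<and>
        (\<forall>u v. (u, v) \<in> parcs H \<longrightarrow> (g u, g v) \<in> parcs G)"
    then obtain g where g: "inj_on g (pverts H)" "g ` pverts H \<subseteq> pverts G"
      "\<And>u v. (u, v) \<in> parcs H \<Longrightarrow> (g u, g v) \<in> parcs G" by auto
    define h where "h = \<lparr> iso_verts = g, iso_arcs = map_prod g g, iso_head = snd, iso_tail = fst \<rparr>"
    have "inj_on (map_prod g g) (parcs H)"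
      using g(1) by (auto simp: inj_on_def) (meson H.in_arcsD1 H.in_arcsD2)+
    then have h: "pre_digraph.digraph_isomorphism (with_proj H) h"
      using g(1) H.wf_digraph unfolding pre_digraph.digraph_isomorphism_def
      by (auto simp: h_def)
    have "wf_digraph (app_iso h (with_proj H))"
      by unfold_locales (auto simp: h_def dest: H.in_arcsD1 H.in_arcsD2)
    then have "subgraph (app_iso h (with_proj H)) (with_proj G)"
      using g(2,3) G.wf_digraph unfolding subgraph_def compatible_def
      by (auto simp: h_def)
    then show "contains_copy G H"
      using h unfolding contains_copy_def digraph_iso_def by blast
  }
qed

lemma ramsey_number_exists:
  assumes "pair_graph H1" "pair_graph H2"
  shows "\<exists>N. \<forall>G :: nat pair_pre_digraph. pair_graph G \<and> card (pverts G) = N \<longrightarrow>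
        contains_copy G H1 \<or> contains_copy (graph_complement G) H2"
proof -
  interpret H1: pair_graph H1 by fact
  interpret H2: pair_graph H2 by fact
  let ?m = "card (pverts H1)" and ?n = "card (pverts H2)"
  obtain r where r: "\<And>(V :: nat set) E. finite V \<Longrightarrow> card V \<ge> r \<Longrightarrow>
      \<exists>R \<subseteq> V. card R = ?m \<and> clique R E \<or> card R = ?n \<and> indep R E"
    using ramsey2[of ?m ?n] by blast
  have copy: "contains_copy K H"
    if K: "pair_graph K" and H: "pair_graph H" and R: "R \<subseteq> pverts K" "card R = card (pverts H)"
      and complete: "\<And>u v. u \<in> R \<Longrightarrow> v \<in> R \<Longrightarrow> u \<noteq> v \<Longrightarrow> (u, v) \<in> parcs K"
    for K :: "nat pair_pre_digraph" and H :: "'c pair_pre_digraph" and R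
  proof -
    interpret K: pair_graph K by fact
    interpret H: pair_graph H by fact
    have "finite R" using R(1) K.pair_finite_verts by (rule finite_subset)
    then obtain g where g: "bij_betw g (pverts H) R"
      using R(2) H.pair_finite_verts by (metis finite_same_card_bij)
    have "(g u, g v) \<in> parcs K" if uv: "(u, v) \<in> parcs H" for u v
    proof (rule complete)
      have u: "u \<in> pverts H" and v: "v \<in> pverts H" and "u \<noteq> v"
        using uv H.in_arcsD1 H.in_arcsD2 H.pair_no_loops[OF uv] by auto
      then show "g u \<in> R" "g v \<in> R" "g u \<noteq> g v"
        using g by (auto simp: bij_betw_def inj_on_def)
    qed
    then show ?thesis
      using g R(1) unfolding contains_copy_iff_embedding[OF K H] bij_betw_def by blast
  qed
  show ?thesis
  proof (intro exI[of _ r] allI impI)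
    fix G :: "nat pair_pre_digraph"
    assume G: "pair_graph G \<and> card (pverts G) = r"
    then interpret pair_graph G by simp
    have sym: "(v, u) \<in> parcs G" if "(u, v) \<in> parcs G" for u v
      using that pair_sym_arcs by (auto simp: symmetric_def sym_def)
    define E where "E = {{u, v} | u v. (u, v) \<in> parcs G}"
    have E: "{u, v} \<in> E \<longleftrightarrow> (u, v) \<in> parcs G" for u v
      using sym by (auto simp: E_def doubleton_eq_iff)
    from r[OF pair_finite_verts, of E] G obtain R where R: "R \<subseteq> pverts G"
      and "card R = ?m \<and> clique R E \<or> card R = ?n \<and> indep R E" by auto
    then consider "card R = ?m" "clique R E" | "card R = ?n" "indep R E" by blast
    then show "contains_copy G H1 \<or> contains_copy (graph_complement G) H2"
    proof cases
      case 1
      then have "contains_copy G H1"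
        using G assms(1) R by (intro copy[of _ _ R]) (auto simp: clique_def E)
      then show ?thesis ..
    next
      case 2
      then have "contains_copy (graph_complement G) H2"
        using G assms(2) R pair_graph_complement[of G]
        by (intro copy[of _ _ R]) (auto simp: indep_def E graph_complement_def)
      then show ?thesis ..
    qed
  qed
qed

end

theory Submission
  imports Defs
begin

text \<open>
  A graph on \<open>N\<close> vertices shows \<open>N < f(n)\<close> exactly when it has no four-cycle and all its degrees
  are at least \<open>N - n\<close>: a vertex is the centre of a copy of \<open>K\<^sub>1\<^sub>,\<^sub>n\<close> in the complement iff it has at
  least \<open>n\<close> non-neighbours besides itself. For the strict inequality, and not merely \<open>N \<noteq> f(n)\<close>,
  one uses that deleting vertices from such a graph leaves such a graph
  (\<open>star_critical_restrict\<close>, \<open>less_ramsey_C4_star_iff\<close>).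

  Suppose now \<open>f(a + b) > a + 2b\<close>. Then there is a graph on \<open>a + 2b\<close> vertices without four-cycles
  and with all degrees at least \<open>b\<close>. Delete from it a vertex \<open>v\<close> of minimum degree and \<open>b\<close> of the
  neighbours of \<open>v\<close>. As there are no four-cycles, every other vertex has at most one neighbour
  among the neighbours of \<open>v\<close>. A survivor not adjacent to \<open>v\<close> therefore loses at most one
  neighbour. A survivor adjacent to \<open>v\<close> may lose two, but such a survivor exists only when \<open>v\<close>,
  and hence by minimality every vertex, has degree at least \<open>b + 1\<close>. So all degrees remain at least
  \<open>b - 1\<close> on the remaining \<open>a + b - 1\<close> vertices, which gives \<open>f(a) > a + b - 1\<close>
  (\<open>star_critical_reduce\<close>).
\<close>

definition nbhd :: "'a pair_pre_digraph \<Rightarrow> 'a \<Rightarrow> 'a set" where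
  "nbhd G v = parcs G `` {v}"

definition induced :: "'a pair_pre_digraph \<Rightarrow> 'a set \<Rightarrow> 'a pair_pre_digraph" where
  "induced G R = \<lparr> pverts = R, parcs = parcs G \<inter> R \<times> R \<rparr>"

text \<open>In a loop-free symmetric graph a four-cycle amounts to two distinct vertices with two distinct
  common neighbours.\<close>

definition C4_free :: "'a pair_pre_digraph \<Rightarrow> bool" where
  "C4_free G \<longleftrightarrow> (\<forall>u w x y. x \<in> nbhd G u \<inter> nbhd G w \<and> y \<in> nbhd G u \<inter> nbhd G w \<longrightarrow> u = w \<or> x = y)"

text \<open>The degree condition is written without subtraction, so that it carries no truncation
  when \<open>n\<close> exceeds the number of vertices.\<close>

definition star_critical :: "nat \<Rightarrow> 'a pair_pre_digraph \<Rightarrow> bool" where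
  "star_critical n G \<longleftrightarrow> pair_graph G \<and> C4_free G \<and>
     (\<forall>v \<in> pverts G. card (pverts G) \<le> card (nbhd G v) + n)"

section \<open>Copies of the four-cycle and of stars\<close>

lemma pair_graph_facts:
  assumes "pair_graph G"
  shows "finite (pverts G)" "(u, v) \<in> parcs G \<Longrightarrow> u \<in> pverts G \<and> v \<in> pverts G \<and> u \<noteq> v"
    "(u, v) \<in> parcs G \<Longrightarrow> (v, u) \<in> parcs G" "nbhd G v \<subseteq> pverts G" "finite (nbhd G v)"
    "v \<notin> nbhd G v"
proof -
  interpret pair_graph G by fact
  show fin: "finite (pverts G)" by simp
  show arc: "(u, v) \<in> parcs G \<Longrightarrow> u \<in> pverts G \<and> v \<in> pverts G \<and> u \<noteq> v" for u v
    using in_arcsD1 in_arcsD2 pair_no_loops by fastforce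
  show "(u, v) \<in> parcs G \<Longrightarrow> (v, u) \<in> parcs G"
    using pair_sym_arcs by (auto simp: symmetric_def sym_def)
  show sub: "nbhd G v \<subseteq> pverts G" using arc by (auto simp: nbhd_def)
  show "finite (nbhd G v)" using sub fin by (rule finite_subset)
  show "v \<notin> nbhd G v" using arc by (auto simp: nbhd_def)
qed

lemma contains_cycle4_iff:
  assumes G: "pair_graph G"
  shows "contains_copy G cycle4 \<longleftrightarrow> \<not> C4_free G"
proof
  assume "contains_copy G cycle4"
  then obtain g where inj: "inj_on g {0, 1, 2, 3 :: nat}"
    and g: "\<And>u v. (u, v) \<in> parcs cycle4 \<Longrightarrow> (g u, g v) \<in> parcs G"
    unfolding contains_copy_iff_embedding[OF G pair_graph_cycle4] by (auto simp: cycle4_def)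
  have "g 1 \<in> nbhd G (g 0) \<inter> nbhd G (g 2)" "g 3 \<in> nbhd G (g 0) \<inter> nbhd G (g 2)"
    by (auto simp: nbhd_def intro!: g) (auto simp: cycle4_def)
  moreover have "g 0 \<noteq> g 2" "g 1 \<noteq> g 3"
    using inj by (auto simp: inj_on_def)
  ultimately show "\<not> C4_free G" unfolding C4_free_def by blast
next
  assume "\<not> C4_free G"
  then obtain u w x y where arcs: "(u, x) \<in> parcs G" "(u, y) \<in> parcs G" "(w, x) \<in> parcs G"
    "(w, y) \<in> parcs G" and "u \<noteq> w" "x \<noteq> y"
    unfolding C4_free_def nbhd_def by auto
  define g :: "nat \<Rightarrow> 'a"
    where "g i = (if i = 0 then u else if i = 1 then x else if i = 2 then w else y)" for i
  have "inj_on g (pverts cycle4)"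
    using \<open>u \<noteq> w\<close> \<open>x \<noteq> y\<close> arcs pair_graph_facts(2)[OF G]
    by (auto simp: g_def cycle4_def inj_on_def)
  moreover have "g ` pverts cycle4 \<subseteq> pverts G"
    using arcs pair_graph_facts(2)[OF G] by (auto simp: g_def cycle4_def)
  moreover have "\<forall>i j. (i, j) \<in> parcs cycle4 \<longrightarrow> (g i, g j) \<in> parcs G"
    using arcs arcs[THEN pair_graph_facts(3)[OF G]] by (auto simp: g_def cycle4_def)
  ultimately show "contains_copy G cycle4"
    unfolding contains_copy_iff_embedding[OF G pair_graph_cycle4] by blast
qed

lemma pair_graph_star: "pair_graph (star n)"
  by (rule pair_graphI) (auto simp: star_def sym_def)

lemma pverts_star: "pverts (star n) = {0..n}"
  by (simp add: star_def)

lemma contains_star_iff: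
  assumes G: "pair_graph G"
  shows "contains_copy G (star n) \<longleftrightarrow> (\<exists>v \<in> pverts G. n \<le> card (nbhd G v))"
proof
  assume "contains_copy G (star n)"
  then obtain g where inj: "inj_on g {0..n}" and V: "g ` {0..n} \<subseteq> pverts G"
    and g: "\<And>u v. (u, v) \<in> parcs (star n) \<Longrightarrow> (g u, g v) \<in> parcs G"
    unfolding contains_copy_iff_embedding[OF G pair_graph_star] pverts_star by blast
  have "g ` {1..n} \<subseteq> nbhd G (g 0)"
    using g by (auto simp: nbhd_def star_def)
  then have "card (g ` {1..n}) \<le> card (nbhd G (g 0))"
    by (intro card_mono pair_graph_facts(5)[OF G])
  moreover have "card (g ` {1..n}) = n"
    using inj by (subst card_image) (auto intro: inj_on_subset)
  ultimately show "\<exists>v \<in> pverts G. n \<le> card (nbhd G v)"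
    using V by (intro bexI[of _ "g 0"]) auto
next
  assume "\<exists>v \<in> pverts G. n \<le> card (nbhd G v)"
  then obtain v S where v: "v \<in> pverts G" and S: "S \<subseteq> nbhd G v" "card S = n" "finite S"
    by (meson obtain_subset_with_card_n)
  then obtain h where h: "bij_betw h {1..n} S"
    by (metis card_atLeastAtMost diff_Suc_1 finite_atLeastAtMost finite_same_card_bij)
  define g where "g i = (if i = 0 then v else h i)" for i
  have hS: "h i \<in> S" if "i \<in> {1..n}" for i using h that by (auto simp: bij_betw_def)
  have "v \<notin> S" using S pair_graph_facts(6)[OF G] by auto
  have inj: "inj_on h {1..n}" using h by (simp add: bij_betw_def)
  have "inj_on g (pverts (star n))"
  proof (rule inj_onI)
    fix i j
    assume "i \<in> pverts (star n)" "j \<in> pverts (star n)" and eq: "g i = g j"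
    then have "i = 0 \<or> i \<in> {1..n}" "j = 0 \<or> j \<in> {1..n}"
      by (auto simp: pverts_star)
    moreover have "h k \<noteq> v" if "k \<in> {1..n}" for k
      using hS[OF that] \<open>v \<notin> S\<close> by blast
    ultimately show "i = j"
      using eq inj_onD[OF inj, of i j] unfolding g_def by (metis (full_types))
  qed
  moreover have "h i \<in> pverts G" if "i \<in> {1..n}" for i
    using hS[OF that] S(1) pair_graph_facts(4)[OF G, of v] by blast
  then have "g ` pverts (star n) \<subseteq> pverts G"
    using v by (auto simp: g_def star_def)
  moreover have "(v, h i) \<in> parcs G" "(h i, v) \<in> parcs G" if "i \<in> {1..n}" for i
  proof -
    show "(v, h i) \<in> parcs G" using hS[OF that] S(1) by (auto simp: nbhd_def)
    then show "(h i, v) \<in> parcs G" by (rule pair_graph_facts(3)[OF G])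
  qed
  then have "\<forall>i j. (i, j) \<in> parcs (star n) \<longrightarrow> (g i, g j) \<in> parcs G"
    by (auto simp: g_def star_def)
  ultimately show "contains_copy G (star n)"
    unfolding contains_copy_iff_embedding[OF G pair_graph_star] by blast
qed

lemma card_nbhd_complement:
  assumes G: "pair_graph G" and v: "v \<in> pverts G"
  shows "card (nbhd (graph_complement G) v) + card (nbhd G v) + 1 = card (pverts G)"
proof -
  have "pverts G = insert v (nbhd (graph_complement G) v \<union> nbhd G v)"
    using v pair_graph_facts(4)[OF G, of v] by (auto simp: nbhd_def graph_complement_def)
  moreover have "v \<notin> nbhd (graph_complement G) v \<union> nbhd G v"
    and "nbhd (graph_complement G) v \<inter> nbhd G v = {}"
    using pair_graph_facts(6)[OF G, of v] by (auto simp: nbhd_def graph_complement_def)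
  moreover have "finite (nbhd (graph_complement G) v)" "finite (nbhd G v)"
    using pair_graph_facts(5)[OF G] pair_graph_facts(5)[OF pair_graph_complement[OF G]] by auto
  ultimately show ?thesis by (simp add: card_Un_disjoint)
qed

lemma star_critical_iff:
  assumes G: "pair_graph G"
  shows "star_critical n G \<longleftrightarrow>
    \<not> contains_copy G cycle4 \<and> \<not> contains_copy (graph_complement G) (star n)"
proof -
  have "card (pverts G) \<le> card (nbhd G v) + n \<longleftrightarrow> \<not> n \<le> card (nbhd (graph_complement G) v)"
    if "v \<in> pverts G" for v
    using card_nbhd_complement[OF G that] by linarith
  moreover have "pverts (graph_complement G) = pverts G" by (simp add: graph_complement_def)
  ultimately show ?thesis
    using G unfolding star_critical_def contains_cycle4_iff[OF G]
      contains_star_iff[OF pair_graph_complement[OF G]] by auto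
qed

section \<open>Deleting vertices\<close>

lemma pverts_induced [simp]: "pverts (induced G R) = R"
  by (simp add: induced_def)

lemma pair_graph_induced:
  assumes "pair_graph G" "R \<subseteq> pverts G"
  shows "pair_graph (induced G R)"
proof (rule pair_graphI)
  show "finite (pverts (induced G R))"
    using assms pair_graph_facts(1) by (auto simp: induced_def intro: finite_subset)
  show "sym (parcs (induced G R))"
    using pair_graph_facts(3)[OF assms(1)] by (auto simp: induced_def sym_def)
qed (use pair_graph_facts(2)[OF assms(1)] in \<open>auto simp: induced_def\<close>)

lemma nbhd_induced: "v \<in> R \<Longrightarrow> nbhd (induced G R) v = nbhd G v \<inter> R"
  by (auto simp: nbhd_def induced_def)

lemma C4_free_induced: "C4_free G \<Longrightarrow> C4_free (induced G R)"
  by (auto simp: C4_free_def nbhd_def induced_def)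

text \<open>Deleting \<open>k\<close> vertices lowers each degree by at most \<open>k\<close>, that is, by no more
  than it lowers the number of vertices.\<close>

lemma star_critical_restrict:
  assumes crit: "star_critical n G" and R: "R \<subseteq> pverts G"
  shows "star_critical n (induced G R)"
proof -
  have G: "pair_graph G" using crit by (simp add: star_critical_def)
  have "card R \<le> card (nbhd G v \<inter> R) + n" if "v \<in> R" for v
  proof -
    have fin: "finite (pverts G)" "finite R"
      using pair_graph_facts(1)[OF G] R finite_subset by auto
    have "card (nbhd G v) \<le> card ((nbhd G v \<inter> R) \<union> (pverts G - R))"
      using pair_graph_facts(4)[OF G, of v] fin by (intro card_mono) auto
    also have "\<dots> \<le> card (nbhd G v \<inter> R) + card (pverts G - R)"
      by (rule card_Un_le)
    also have "card (pverts G - R) = card (pverts G) - card R"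
      using R fin by (simp add: card_Diff_subset)
    finally have "card (nbhd G v) \<le> card (nbhd G v \<inter> R) + (card (pverts G) - card R)" .
    moreover have "card R \<le> card (pverts G)" using R fin by (intro card_mono)
    moreover have "card (pverts G) \<le> card (nbhd G v) + n"
      using crit R that by (auto simp: star_critical_def)
    ultimately show ?thesis by linarith
  qed
  then show ?thesis
    using crit pair_graph_induced[OF G R] C4_free_induced[of G R]
    by (simp add: star_critical_def nbhd_induced)
qed

lemma less_ramsey_C4_star_iff:
  "N < ramsey_C4_star n \<longleftrightarrow>
     (\<exists>G :: nat pair_pre_digraph. star_critical n G \<and> card (pverts G) = N)"
proof -
  define P where "P N \<longleftrightarrow> (\<forall>G :: nat pair_pre_digraph. pair_graph G \<and> card (pverts G) = N \<longrightarrow>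
        contains_copy G cycle4 \<or> contains_copy (graph_complement G) (star n))" for N
  have notP: "\<not> P N \<longleftrightarrow> (\<exists>G :: nat pair_pre_digraph. star_critical n G \<and> card (pverts G) = N)" for N
    using star_critical_iff unfolding P_def star_critical_def by blast
  have f: "ramsey_C4_star n = (LEAST N. P N)"
    by (simp add: ramsey_C4_star_def ramsey_number_def P_def)
  have "\<exists>N. P N"
    unfolding P_def by (rule ramsey_number_exists[OF pair_graph_cycle4 pair_graph_star])
  then have "P (ramsey_C4_star n)"
    unfolding f by (rule LeastI_ex)
  moreover have "P N" if "P M" "M \<le> N" for M N
  proof (rule ccontr)
    assume "\<not> P N"
    then obtain G :: "nat pair_pre_digraph" where G: "star_critical n G" "card (pverts G) = N"
      by (auto simp: notP)
    then obtain R where R: "R \<subseteq> pverts G" "card R = M"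
      using \<open>M \<le> N\<close> by (metis obtain_subset_with_card_n)
    have "\<not> P M"
      unfolding notP using star_critical_restrict[OF G(1) R(1)] R(2)
      by (intro exI[of _ "induced G R"]) simp
    then show False using \<open>P M\<close> by contradiction
  qed
  ultimately have "N < ramsey_C4_star n \<longleftrightarrow> \<not> P N"
    using not_less_Least[of N P] f by (metis not_le)
  then show ?thesis by (simp add: notP)
qed

section \<open>Deleting a vertex together with some of its neighbours\<close>

text \<open>The vertex \<open>v\<close> has to have minimum degree: this is what compensates for the second
  neighbour, \<open>v\<close> itself, that is lost by the neighbours of \<open>v\<close> that are kept.\<close>

lemma star_critical_reduce:
  fixes G :: "'a pair_pre_digraph"
  assumes "b > 0" and crit: "star_critical (a + b) G" and order: "card (pverts G) = a + 2 * b"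
  shows "\<exists>R \<subseteq> pverts G. star_critical a (induced G R) \<and> card R = a + b - 1"
proof -
  have G: "pair_graph G" and C4: "C4_free G" using crit by (auto simp: star_critical_def)
  have fin: "finite (pverts G)" by (rule pair_graph_facts(1)[OF G])
  have deg: "b \<le> card (nbhd G v)" if "v \<in> pverts G" for v
    using crit that order by (auto simp: star_critical_def)
  have "pverts G \<noteq> {}" using order \<open>b > 0\<close> by auto
  then obtain v where v: "v \<in> pverts G"
    and min: "\<And>w. w \<in> pverts G \<Longrightarrow> card (nbhd G v) \<le> card (nbhd G w)"
    using ex_is_arg_min_if_finite[OF fin, of "\<lambda>v. card (nbhd G v)"]
    by (auto simp: is_arg_min_def not_less)
  obtain S where S: "S \<subseteq> nbhd G v" "card S = b" "finite S"
    using deg[OF v] by (meson obtain_subset_with_card_n)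
  define R where "R = pverts G - insert v S"
  have "v \<notin> S" "insert v S \<subseteq> pverts G"
    using S v pair_graph_facts(4,6)[OF G, of v] by auto
  then have card_R: "card R = a + b - 1"
    unfolding R_def using S order by (simp add: card_Diff_subset)
  have "card R \<le> card (nbhd G w \<inter> R) + a" if w: "w \<in> R" for w
  proof -
    have "w \<noteq> v" "w \<in> pverts G" "w \<notin> S" using w by (auto simp: R_def)
    have "\<forall>x \<in> nbhd G w \<inter> S. \<forall>y \<in> nbhd G w \<inter> S. x = y"
      using C4 S(1) \<open>w \<noteq> v\<close> unfolding C4_free_def by blast
    then have one: "card (nbhd G w \<inter> S) \<le> 1"
      using S(3) by (auto simp: card_le_Suc0_iff_eq)
    have "nbhd G w = (nbhd G w \<inter> R) \<union> (nbhd G w \<inter> S) \<union> (nbhd G w \<inter> {v})"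
      using pair_graph_facts(4)[OF G, of w] by (auto simp: R_def)
    then have "card (nbhd G w) \<le>
        card ((nbhd G w \<inter> R) \<union> (nbhd G w \<inter> S)) + card (nbhd G w \<inter> {v})"
      by (metis card_Un_le)
    also have "\<dots> \<le> card (nbhd G w \<inter> R) + card (nbhd G w \<inter> S) + card (nbhd G w \<inter> {v})"
      by (intro add_right_mono card_Un_le)
    finally have split: "card (nbhd G w) \<le>
        card (nbhd G w \<inter> R) + card (nbhd G w \<inter> S) + card (nbhd G w \<inter> {v})" .
    have "b + card (nbhd G w \<inter> {v}) \<le> card (nbhd G w)"
    proof (cases "v \<in> nbhd G w")
      case True
      then have "w \<in> nbhd G v" using pair_graph_facts(3)[OF G] by (auto simp: nbhd_def)
      then have "card S < card (nbhd G v)"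
        using S(1) \<open>w \<notin> S\<close> pair_graph_facts(5)[OF G, of v] by (intro psubset_card_mono) auto
      then have "b + 1 \<le> card (nbhd G w)" using min[OF \<open>w \<in> pverts G\<close>] S(2) by linarith
      then show ?thesis using True by simp
    next
      case False
      then show ?thesis using deg[OF \<open>w \<in> pverts G\<close>] by simp
    qed
    then show ?thesis using split one card_R by linarith
  qed
  then have "star_critical a (induced G R)"
    using pair_graph_induced[OF G, of R] C4_free_induced[OF C4, of R]
    by (auto simp: star_critical_def nbhd_induced R_def)
  then show ?thesis using card_R by (intro exI[of _ R]) (auto simp: R_def)
qed

theorem theorem6:
  fixes a b :: nat
  assumes "a > 0" and "b > 0"
  shows "ramsey_C4_star a \<ge> a + b \<or> ramsey_C4_star (a + b) \<le> a + 2 * b"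
proof (rule disjCI)
  assume "\<not> ramsey_C4_star (a + b) \<le> a + 2 * b"
  then obtain G :: "nat pair_pre_digraph"
    where "star_critical (a + b) G" "card (pverts G) = a + 2 * b"
    using less_ramsey_C4_star_iff[of "a + 2 * b" "a + b"] by (auto simp: not_le)
  then obtain R where "star_critical a (induced G R)" "card R = a + b - 1"
    using star_critical_reduce[OF \<open>b > 0\<close>] by blast
  then have "a + b - 1 < ramsey_C4_star a"
    unfolding less_ramsey_C4_star_iff by (intro exI[of _ "induced G R"]) simp
  then show "a + b \<le> ramsey_C4_star a" by linarith
qed

end
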